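(* Let $d\ge2$ be an integer. Then the functions $r\mapsto r^{2-d}U^{\langle d\rangle}(r)$ and $r\mapsto W^{\langle d\rangle}(r)$ are constant on $[0,1]$ and monotonically decreasing on $[1,\infty)$, where the value of $r^{2-d}U^{\langle d\rangle}(r)$ at $r=0$ is understood by continuous extension.
   Context: Let $U:[0,\infty)\to\mathbb{R}$, $U(r)=\tfrac12$ for $r\le 1$ and $U(r)=\tfrac12-\tfrac1\pi\operatorname{arcsec}(r)$ for $r>1$. For integer $d\ge2$ define $U^{\langle d\rangle}:[0,\infty)\to\mathbb{R}$ by $$U^{\langle d\rangle}(r)=U(r)-\int_1^\infty U(tr)(d-2)t^{1-d}\,dt,$$ which equals $\frac{r^{d-2}}{\pi}\int_1^\infty\frac{t^{1-d}}{\sqrt{t^2-1}}dt$ for $r\le1$ and $\frac1\pi\int_1^\infty\frac{t^{1-d}}{\sqrt{r^2t^2-1}}dt$ for $r>1$. For $r>0$ define $$W^{\langle d\rangle}(r)=\frac{2}{\Gamma(d-1)\operatorname{vol}(S^{d-1})}\,\frac{1}{r^d}\int_0^r U^{\langle d\rangle}(t)\,t\,dt,$$ where $\operatorname{vol}(S^{d-1})=2\pi^{d/2}/\Gamma(d/2)$, and $W^{\langle d\rangle}(0)=\lim_{r\to0}W^{\langle d\rangle}(r)=\operatorname{vol}(\mathbb{B}^d)/(2\pi)^d$, with $\mathbb{B}^d$ the unit ball of $\mathbb{R}^d$. *)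

theory Defs
  imports "HOL-Analysis.Analysis"
begin

text \<open>All functions below have domain \<open>[0,\<infinity>)\<close> on paper; their values at negative reals
  are irrelevant.\<close>

definition arcsec :: "real \<Rightarrow> real" where
  "arcsec r = arccos (1 / r)"

definition U :: "real \<Rightarrow> real" where
  "U r = (if r \<le> 1 then 1 / 2 else 1 / 2 - arcsec r / pi)"

text \<open>For \<open>d \<ge> 2\<close> and \<open>r \<ge> 0\<close> the integrand is nonnegative, so the Henstock--Kurzweil integral
  agrees with the Lebesgue integral.\<close>

definition Ud :: "nat \<Rightarrow> real \<Rightarrow> real" where
  "Ud d r = U r - integral {1..} (\<lambda>t. U (t * r) * (real d - 2) * t powi (1 - int d))"

text \<open>The value at \<open>0\<close> is the continuous extension from within \<open>[0,\<infinity>)\<close>. If the limit did not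
  exist, \<^const>\<open>Lim\<close> would be unspecified; constancy on \<open>{0<..1}\<close> guarantees existence.\<close>

definition scaled_Ud :: "nat \<Rightarrow> real \<Rightarrow> real" where
  "scaled_Ud d r =
     (if r = 0 then Lim (at_right 0) (\<lambda>s. s powi (2 - int d) * Ud d s)
      else r powi (2 - int d) * Ud d r)"

text \<open>Volume of the unit sphere \<open>S\<^bsup>d-1\<^esup>\<close> in \<open>\<real>\<^bsup>d\<^esup>\<close>.\<close>

definition sphere_vol :: "nat \<Rightarrow> real" where
  "sphere_vol d = 2 * pi powr (real d / 2) / Gamma (real d / 2)"

text \<open>At \<open>0\<close> we take the closed form of the limit of \<open>Wd d r\<close> as \<open>r \<rightarrow> 0\<close>. Constancy of \<open>Wd d\<close>
  on \<open>{0..1}\<close> entails in particular that this value is indeed the limit.\<close>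

definition Wd :: "nat \<Rightarrow> real \<Rightarrow> real" where
  "Wd d r =
     (if r = 0 then unit_ball_vol (real d) / (2 * pi) ^ d
      else 2 / (Gamma (real d - 1) * sphere_vol d) * (1 / r ^ d)
             * integral {0..r} (\<lambda>t. Ud d t * t))"

end

theory Submission
  imports Defs
begin

text \<open>
  Write \<open>d = n + 2\<close>, let \<open>J x\<close> be the integral of \<open>sin ^ n\<close> over \<open>[0, x]\<close>, and put
  \<open>\<theta> r = arcsin (1 / max 1 r)\<close>, so that \<open>U = \<theta> / \<pi>\<close>. Since \<open>sin (\<theta> r) = 1 / r\<close> for \<open>r > 1\<close>, the
  function \<open>J (\<theta> r) / \<pi> - U r / r ^ n\<close> is an antiderivative of \<open>n U r / r ^ (n + 1)\<close> vanishing at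
  infinity, whence the scaled \<open>Ud\<close> equals \<open>J (\<theta> r) / \<pi>\<close>: constant for \<open>r \<le> 1\<close> and decreasing
  afterwards. Moreover \<open>Wd\<close> is a positive multiple of the average of this function over \<open>[0, r]\<close>
  with weight \<open>t ^ (n + 1)\<close>. Its value on \<open>(0, 1]\<close> agrees with the prescribed one at \<open>0\<close> by Wallis'
  formula for \<open>J (\<pi> / 2)\<close> and Legendre's duplication formula.
\<close>

section \<open>Integrals of powers of sine and Wallis' formula\<close>

definition sin_pow_integral :: "nat \<Rightarrow> real \<Rightarrow> real" where
  "sin_pow_integral n x = integral {0..x} (\<lambda>u. sin u ^ n)"

lemma sin_pow_integral_0 [simp]: "sin_pow_integral n 0 = 0"
  by (simp add: sin_pow_integral_def)

lemma sin_pow_integral_mono: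
  assumes "0 \<le> x" "x \<le> y" "y \<le> pi"
  shows "sin_pow_integral n x \<le> sin_pow_integral n y"
  unfolding sin_pow_integral_def
  using assms by (intro integral_subset_le integrable_continuous_interval continuous_intros)
    (auto intro!: sin_ge_zero zero_le_power)

lemma continuous_on_sin_pow_integral: "continuous_on {0..b} (sin_pow_integral n)"
  unfolding sin_pow_integral_def [abs_def]
  by (intro indefinite_integral_continuous_1 integrable_continuous_interval continuous_intros)

lemma DERIV_sin_pow_integral:
  assumes "0 < x"
  shows "(sin_pow_integral n has_real_derivative sin x ^ n) (at x)"
proof -
  have "(sin_pow_integral n has_real_derivative sin x ^ n) (at x within {0..x + 1})"
    unfolding sin_pow_integral_def [abs_def] using assms
    by (intro integral_has_real_derivative continuous_intros) auto
  then show ?thesis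
    using assms by (simp add: at_within_Icc_at)
qed

lemma Gamma_plus1_pos: "0 < x \<Longrightarrow> Gamma (x + 1) = x * Gamma x" for x :: real
  by (rule Gamma_plus1) (auto elim: nonpos_Ints_cases)

text \<open>Integrating the derivative of \<open>- sin u ^ (n + 1) * cos u\<close> over
  \<open>[0, pi / 2]\<close> relates exponents \<open>n + 2\<close> and \<open>n\<close>, and the
  functional equation of \<open>Gamma\<close> gives the same recursion on the right. Hence the
  induction in steps of two.\<close>

lemma sin_pow_integral_pi_half:
  "sin_pow_integral n (pi / 2) = sqrt pi / 2 * Gamma ((real n + 1) / 2) / Gamma (real n / 2 + 1)"
proof (induction n rule: nat_induct2)
  case 0
  then show ?case by (simp add: sin_pow_integral_def Gamma_one_half_real)
next
  case 1
  have "((\<lambda>u. sin u ^ 1) has_integral (- cos (pi / 2) - - cos 0)) {0..pi / 2}"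
    by (intro fundamental_theorem_of_calculus)
      (auto intro!: derivative_eq_intros simp flip: has_real_derivative_iff_has_vector_derivative)
  then show ?case
    using Gamma_plus1_pos [of "1/2"] Gamma_real_pos [of "3/2"]
    by (auto simp: sin_pow_integral_def Gamma_one_half_real integral_unique)
next
  case (step n)
  have int: "(\<lambda>u. sin u ^ k) integrable_on {0..pi/2}" for k
    by (intro integrable_continuous_interval continuous_intros)
  have "((\<lambda>u. (real n + 2) * sin u ^ (n + 2) - (real n + 1) * sin u ^ n) has_integral
      (- (sin (pi / 2) ^ (n + 1) * cos (pi / 2)) - - (sin 0 ^ (n + 1) * cos 0))) {0..pi / 2}"
  proof (intro fundamental_theorem_of_calculus)
    fix x :: real
    have eq: "(real n + 2) * sin x ^ (n + 2) - (real n + 1) * sin x ^ n =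
      - (sin x ^ (n + 1) * (- sin x) + (real n + 1) * (sin x ^ n * cos x) * cos x)"
    proof -
      have "cos x * cos x = 1 - sin x * sin x"
        using sin_cos_squared_add [of x] by (simp add: power2_eq_square)
      then have "(real n + 1) * (sin x ^ n * cos x) * cos x = (real n + 1) * sin x ^ n * (1 - sin x * sin x)"
        by (simp add: mult.assoc)
      then show ?thesis by (simp add: algebra_simps)
    qed
    have "((\<lambda>u. - (sin u ^ (n + 1) * cos u)) has_real_derivative
        (real n + 2) * sin x ^ (n + 2) - (real n + 1) * sin x ^ n) (at x within {0..pi / 2})"
      unfolding eq
      by (rule has_field_derivative_at_within, rule DERIV_minus,
          rule DERIV_cong [OF DERIV_mult [OF DERIV_power [OF DERIV_sin] DERIV_cos]])
        (simp add: algebra_simps)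
    then show "((\<lambda>u. - (sin u ^ (n + 1) * cos u)) has_vector_derivative
        (real n + 2) * sin x ^ (n + 2) - (real n + 1) * sin x ^ n) (at x within {0..pi / 2})"
      by (simp add: has_real_derivative_iff_has_vector_derivative)
  qed auto
  \<comment> \<open>Both boundary terms vanish: \<open>cos (pi / 2) = 0\<close> at the upper end,
    and \<open>sin 0 ^ (n + 1) = 0\<close> at the lower end because the exponent is
    positive.\<close>
  then have "integral {0..pi/2} (\<lambda>u. (real n + 2) * sin u ^ (n + 2) - (real n + 1) * sin u ^ n) = 0"
    by (auto dest!: integral_unique)
  moreover have "integral {0..pi/2} (\<lambda>u. (real n + 2) * sin u ^ (n + 2) - (real n + 1) * sin u ^ n) =
     (real n + 2) * sin_pow_integral (n + 2) (pi / 2) - (real n + 1) * sin_pow_integral n (pi / 2)"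
    unfolding sin_pow_integral_def
    by (subst integral_diff) (auto intro: int integrable_on_mult_right simp del: power_Suc power_add)
  ultimately have rec: "(real n + 2) * sin_pow_integral (n + 2) (pi / 2) = (real n + 1) * sin_pow_integral n (pi / 2)"
    by simp
  have G1: "Gamma ((real n + 1) / 2 + 1) = (real n + 1) / 2 * Gamma ((real n + 1) / 2)"
    by (rule Gamma_plus1_pos) (simp add: add_nonneg_pos)
  have G2: "Gamma (real n / 2 + 1 + 1) = (real n / 2 + 1) * Gamma (real n / 2 + 1)"
    by (rule Gamma_plus1_pos) (simp add: add_nonneg_pos)
  have e1: "(real (n + 2) + 1) / 2 = (real n + 1) / 2 + 1"
    and e2: "real (n + 2) / 2 + 1 = real n / 2 + 1 + 1"
    by (simp_all add: field_simps)
  show ?case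
  proof -
    have "sin_pow_integral (n + 2) (pi / 2) = (real n + 1) * sin_pow_integral n (pi / 2) / (real n + 2)"
      using rec by (simp add: eq_divide_eq mult.commute)
    also have "\<dots> = sqrt pi / 2 * ((real n + 1) / 2 * Gamma ((real n + 1) / 2)) /
        ((real n / 2 + 1) * Gamma (real n / 2 + 1))"
      unfolding step by (simp add: divide_simps)
    finally show ?thesis
      unfolding e1 e2 G1 G2 .
  qed
qed

section \<open>The angle function and the profile built from it\<close>

lemma U_eq_arcsin: "U r = arcsin (1 / max 1 r) / pi"
  by (auto simp: U_def arcsec_def max_def arcsin_arccos_eq field_simps)

lemma arcsin_inverse_bounds: "0 < arcsin (1 / max 1 r)" "arcsin (1 / max 1 r) \<le> pi / 2"
proof -
  have "0 < 1 / max 1 r" "1 / max 1 r \<le> 1"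
    by (auto simp: divide_le_eq)
  moreover from this have "- 1 \<le> 1 / max 1 r"
    by linarith
  ultimately show "0 < arcsin (1 / max 1 r)" "arcsin (1 / max 1 r) \<le> pi / 2"
    using arcsin_less_arcsin [of 0 "1 / max 1 r"] arcsin_ubound [of "1 / max 1 r"] by simp_all
qed

lemma arcsin_inverse_antimono: "r \<le> s \<Longrightarrow> arcsin (1 / max 1 s) \<le> arcsin (1 / max 1 r)"
  by (intro arcsin_le_arcsin frac_le) (auto simp: divide_le_eq intro: order_trans [of _ 0])

lemma continuous_on_arcsin_inverse: "continuous_on S (\<lambda>r. arcsin (1 / max 1 r))"
  by (intro continuous_intros) (auto simp: divide_le_eq intro: order_trans [of _ 0])

text \<open>Clamping the argument with \<open>max 1 r\<close> makes the angle \<open>pi / 2\<close>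
  for all \<open>r \<le> 1\<close>, so that one formula covers both regimes, including
  \<open>r = 0\<close>.\<close>

definition profile :: "nat \<Rightarrow> real \<Rightarrow> real" where
  "profile n r = sin_pow_integral n (arcsin (1 / max 1 r)) / pi"

lemma profile_antimono: "r \<le> s \<Longrightarrow> profile n s \<le> profile n r"
  using arcsin_inverse_bounds [of r] arcsin_inverse_bounds [of s] pi_gt_zero
  unfolding profile_def
  by (intro divide_right_mono sin_pow_integral_mono arcsin_inverse_antimono) linarith+

lemma profile_le_1: "r \<le> 1 \<Longrightarrow> profile n r = sin_pow_integral n (pi / 2) / pi"
  by (simp add: profile_def max_def)

lemma continuous_on_profile: "continuous_on S (profile n)"
  unfolding profile_def
  by (intro continuous_intros continuous_on_compose2 [OF continuous_on_sin_pow_integral [of "pi / 2"]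
    continuous_on_arcsin_inverse])
    (auto simp: less_imp_le [OF arcsin_inverse_bounds(1)] arcsin_inverse_bounds(2)
      simp del: le_divide_eq_numeral1)

lemma profile_tendsto_0: "(profile n \<longlongrightarrow> 0) at_top"
proof -
  have "((\<lambda>r. arcsin (1 / max 1 r)) \<longlongrightarrow> arcsin 0) at_top"
  proof (rule isCont_tendsto_compose [where g = arcsin])
    have "((\<lambda>r::real. 1 / r) \<longlongrightarrow> 0) at_top"
      by (simp add: tendsto_inverse_0_at_top filterlim_ident flip: inverse_eq_divide)
    then show "((\<lambda>r::real. 1 / max 1 r) \<longlongrightarrow> 0) at_top"
      by (rule Lim_transform_eventually) (auto intro!: eventually_at_top_linorderI [of 1] simp: max_def)
  qed (intro isCont_arcsin; simp)
  then have "((\<lambda>r. arcsin (1 / max 1 r)) \<longlongrightarrow> 0) at_top" by simp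
  then have "((\<lambda>r. sin_pow_integral n (arcsin (1 / max 1 r))) \<longlongrightarrow> sin_pow_integral n 0) at_top"
    by (intro continuous_on_tendsto_compose [OF continuous_on_sin_pow_integral [of "pi / 2"]])
      (auto simp: less_imp_le [OF arcsin_inverse_bounds(1)] arcsin_inverse_bounds(2)
        simp del: le_divide_eq_numeral1)
  then have "((\<lambda>r. sin_pow_integral n (arcsin (1 / max 1 r)) / pi) \<longlongrightarrow> 0 / pi) at_top"
    by (intro tendsto_intros) auto
  then show ?thesis by (simp add: profile_def [abs_def])
qed

lemma profile_0: "profile 0 r = U r"
  using arcsin_inverse_bounds [of r] by (simp add: profile_def U_eq_arcsin sin_pow_integral_def)

text \<open>As \<open>U\<close> is \<open>profile 0\<close>, one chain rule computation serves both
  derivatives; the factor \<open>1 / r ^ n\<close> is \<open>sin ^ n\<close> at the angle. The point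
  \<open>r = 1\<close> is excluded because the functions have a kink there. A common unnamed
  \<open>D\<close> suffices, since it cancels later.\<close>

lemma U_profile_derivs:
  assumes "r \<noteq> 1" "0 < r"
  obtains D where "(U has_real_derivative D) (at r)"
    "(profile n has_real_derivative D / r ^ n) (at r)"
proof (cases "r < 1")
  case True
  have "(profile k has_real_derivative 0) (at r)" for k
    by (rule has_field_derivative_transform_within_open
        [OF DERIV_const [of "sin_pow_integral k (pi / 2) / pi"], where S = "{..<1}"])
      (use True in \<open>auto simp: profile_le_1\<close>)
  from this [of 0] this [of n] show ?thesis
    by (intro that [of 0]) (simp_all add: profile_0 [abs_def])
next
  case False
  with assms have "1 < r" by simp
  define D where "D = inverse (sqrt (1 - (1 / r)\<^sup>2)) * (- 1 / r\<^sup>2) / pi"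
  have deriv: "((\<lambda>r. arcsin (1 / r)) has_real_derivative D * pi) (at r)"
    unfolding D_def using \<open>1 < r\<close>
    by (auto intro!: derivative_eq_intros simp: power2_eq_square field_simps)
  have pos: "0 < arcsin (1 / r)"
    using arcsin_inverse_bounds(1) [of r] \<open>1 < r\<close> by (simp add: max_def)
  have sin: "sin (arcsin (1 / r)) = 1 / r"
    using \<open>1 < r\<close> by (intro sin_arcsin) (auto intro: order_trans [of _ 0])
  have "(profile k has_real_derivative D / r ^ k) (at r)" for k
  proof (rule has_field_derivative_transform_within_open [where S = "{1<..}"])
    have "((\<lambda>r. sin_pow_integral k (arcsin (1 / r)) / pi) has_real_derivative
        sin (arcsin (1 / r)) ^ k * (D * pi) / pi) (at r)"
      by (intro DERIV_cdivide DERIV_chain2 [OF DERIV_sin_pow_integral deriv] pos)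
    then show "((\<lambda>r. sin_pow_integral k (arcsin (1 / r)) / pi) has_real_derivative D / r ^ k) (at r)"
      by (simp add: sin power_divide)
  qed (use \<open>1 < r\<close> in \<open>auto simp: profile_def max_def\<close>)
  from this [of 0] this [of n] show ?thesis
    by (intro that [of D]) (simp_all add: profile_0 [abs_def])
qed

section \<open>The tail integral of \<open>U\<close> and the closed form of
  \<open>Ud\<close>\<close>

lemma U_nonneg: "0 \<le> U r"
  using arcsin_inverse_bounds [of r] by (simp add: U_eq_arcsin)

text \<open>The integrand is nonnegative, so it is enough to integrate over \<open>{1..y}\<close> by
  means of the antiderivative \<open>G\<close> and let \<open>y\<close> tend to infinity, where
  \<open>G\<close> vanishes.\<close>

lemma has_integral_U_tail:
  assumes "0 < r"
  shows "((\<lambda>t. U (t * r) * real n / t ^ (n + 1)) has_integral (U r - r ^ n * profile n r)) {1..}"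
proof (rule has_integral_to_inf)
  define G where "G t = r ^ n * profile n (t * r) - U (t * r) / t ^ n" for t
  let ?g = "\<lambda>t. U (t * r) * real n / t ^ (n + 1)"
  have deriv: "(G has_real_derivative ?g t) (at t)" if "0 < t" "t \<noteq> 1 / r" for t
  proof -
    have "t * r \<noteq> 1" "0 < t * r"
      using that assms by (auto simp: field_simps)
    then obtain D where D: "(U has_real_derivative D) (at (t * r))"
        "(profile n has_real_derivative D / (t * r) ^ n) (at (t * r))"
      by (rule U_profile_derivs)
    have lin: "((\<lambda>t. t * r) has_real_derivative r) (at t)"
      by (auto intro!: derivative_eq_intros)
    have "(G has_real_derivative
        r ^ n * (D / (t * r) ^ n * r) -
        (D * r * t ^ n - U (t * r) * (real n * t ^ (n - 1))) / (t ^ n * t ^ n)) (at t)"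
      unfolding G_def using that
      by (intro DERIV_diff DERIV_cmult DERIV_divide DERIV_chain2 [OF D(1) lin]
          DERIV_chain2 [OF D(2) lin]) (auto intro!: derivative_eq_intros)
    \<comment> \<open>The two terms with \<open>D\<close> both equal \<open>D * r / t ^ n\<close>
      and cancel. The case split on \<open>n\<close> deals with the truncated exponent
      \<open>n - 1\<close>.\<close>
    also have "r ^ n * (D / (t * r) ^ n * r) -
        (D * r * t ^ n - U (t * r) * (real n * t ^ (n - 1))) / (t ^ n * t ^ n) = ?g t"
      using that assms by (cases n) (simp_all add: field_simps)
    finally show ?thesis .
  qed
  have cont: "continuous_on {1..y} G" for y
    unfolding G_def profile_0 [symmetric]
    by (intro continuous_intros continuous_on_compose2 [OF continuous_on_profile [of UNIV]]) auto
  \<comment> \<open>At the kink \<open>t = 1 / r\<close> only continuity of \<open>G\<close> is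
    available, which the fundamental theorem tolerates at finitely many points.\<close>
  have int: "(?g has_integral (G y - G 1)) {1..y}" if "1 \<le> y" for y
    by (rule fundamental_theorem_of_calculus_interior_strong [of "{1 / r}"])
      (use that cont deriv in \<open>auto simp flip: has_real_derivative_iff_has_vector_derivative\<close>)
  show "?g integrable_on {1..y}" for y
    using int [of y] by (cases "1 \<le> y") (auto simp: integrable_on_def)
  have lim: "((\<lambda>t. profile k (t * r)) \<longlongrightarrow> 0) at_top" for k
    by (rule filterlim_compose [OF profile_tendsto_0])
      (rule filterlim_at_top_mult_tendsto_pos [OF tendsto_const assms filterlim_ident])
  \<comment> \<open>The decay has to come from \<open>U\<close> itself: for \<open>n = 0\<close> the
    denominator contributes nothing.\<close>
  have "((\<lambda>t. U (t * r) / t ^ n) \<longlongrightarrow> 0) at_top"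
  proof (rule tendsto_sandwich [OF _ _ tendsto_const lim [of 0, unfolded profile_0]])
    show "\<forall>\<^sub>F t in at_top. 0 \<le> U (t * r) / t ^ n"
      by (auto intro!: eventually_at_top_linorderI [of 0] divide_nonneg_nonneg U_nonneg)
    show "\<forall>\<^sub>F t in at_top. U (t * r) / t ^ n \<le> U (t * r)"
    proof (rule eventually_at_top_linorderI)
      fix t :: real
      assume "1 \<le> t"
      then show "U (t * r) / t ^ n \<le> U (t * r)"
        using divide_left_mono [of 1 "t ^ n" "U (t * r)"] by (simp add: U_nonneg)
    qed
  qed
  then have "((\<lambda>y. G y - G 1) \<longlongrightarrow> r ^ n * 0 - 0 - G 1) at_top"
    unfolding G_def by (intro tendsto_intros lim)
  then have "((\<lambda>y. G y - G 1) \<longlongrightarrow> U r - r ^ n * profile n r) at_top"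
    by (simp add: G_def)
  then show "((\<lambda>y. integral {1..y} ?g) \<longlongrightarrow> U r - r ^ n * profile n r) at_top"
    by (rule Lim_transform_eventually)
      (intro eventually_at_top_linorderI [of 1] integral_unique [symmetric] int)
  show "0 \<le> ?g y" if "1 \<le> y" for y
    using that by (simp add: U_nonneg)
qed

lemma Ud_eq_profile:
  assumes "0 < r"
  shows "Ud (n + 2) r = r ^ n * profile n r"
proof -
  have "t powi (1 - int (n + 2)) = inverse (t ^ (n + 1))" for t :: real
    by (simp add: power_int_def nat_add_distrib power_inverse)
  then have "integral {1..} (\<lambda>t. U (t * r) * (real (n + 2) - 2) * t powi (1 - int (n + 2))) =
      integral {1..} (\<lambda>t. U (t * r) * real n / t ^ (n + 1))"
    by (simp add: divide_inverse)
  then show ?thesis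
    using integral_unique [OF has_integral_U_tail [OF assms, of n]] by (simp only: Ud_def)
qed

text \<open>For \<open>r = 0\<close> the limit from the right exists because the profile is constant
  on \<open>(0, 1)\<close>.\<close>

lemma scaled_Ud_eq_profile:
  assumes "0 \<le> r"
  shows "scaled_Ud (n + 2) r = profile n r"
proof -
  have pos: "s powi (2 - int (n + 2)) * Ud (n + 2) s = profile n s" if "0 < s" for s
    using that unfolding Ud_eq_profile [OF that] by (simp add: power_int_minus)
  have "((\<lambda>s. s powi (2 - int (n + 2)) * Ud (n + 2) s) \<longlongrightarrow> profile n 0) (at_right 0)"
  proof (rule Lim_transform_eventually [OF tendsto_const])
    show "\<forall>\<^sub>F s in at_right 0. profile n 0 = s powi (2 - int (n + 2)) * Ud (n + 2) s"
      using eventually_at_right_less [of 0] eventually_at_right_real [OF zero_less_one]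
      by eventually_elim (simp only: pos, simp add: profile_le_1)
  qed
  then have "Lim (at_right 0) (\<lambda>s. s powi (2 - int (n + 2)) * Ud (n + 2) s) = profile n 0"
    by (rule tendsto_Lim [OF trivial_limit_at_right_real])
  with pos [of r] assms show ?thesis
    unfolding scaled_Ud_def by auto
qed

section \<open>\<open>Wd\<close> as a weighted average, and its monotonicity\<close>

definition Wd_const :: "nat \<Rightarrow> real" where
  "Wd_const d = 2 / (Gamma (real d - 1) * sphere_vol d)"

lemma Wd_const_pos: "2 \<le> d \<Longrightarrow> 0 < Wd_const d"
  unfolding Wd_const_def sphere_vol_def
  by (intro divide_pos_pos mult_pos_pos Gamma_real_pos) auto

text \<open>The substitution \<open>t = r * u\<close> absorbs the factor \<open>1 / r ^ d\<close>
  and leaves a fixed interval and a fixed nonnegative weight. Monotonicity and constancy of the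
  profile then pass to \<open>Wd\<close> under the integral sign.\<close>

lemma Wd_eq_average:
  assumes "0 < r"
  shows "Wd (n + 2) r = Wd_const (n + 2) * integral {0..1} (\<lambda>u. profile n (r * u) * u ^ (n + 1))"
proof -
  have "integral {0..r} (\<lambda>t. Ud (n + 2) t * t) = integral {0..r} (\<lambda>t. profile n t * t ^ (n + 1))"
  proof (rule integral_cong)
    fix t assume "t \<in> {0..r}"
    \<comment> \<open>The closed form of \<open>Ud\<close> needs \<open>t > 0\<close>; at
      \<open>t = 0\<close> both sides vanish through the factor \<open>t\<close>.\<close>
    then show "Ud (n + 2) t * t = profile n t * t ^ (n + 1)"
      using Ud_eq_profile [of t n] by (cases "t = 0") auto
  qed
  moreover have "integral {0..1} (\<lambda>u. profile n (r * u) * (r * u) ^ (n + 1)) =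
      1 / r * integral {0..r} (\<lambda>t. profile n t * t ^ (n + 1))"
  proof -
    have "(\<lambda>t. t / r) ` {0..r} = {0..1}"
      using assms by (simp add: image_divide_atLeastAtMost)
    then show ?thesis
      using integral_stretch_real [of r 0 r "\<lambda>t. profile n t * t ^ (n + 1)"] assms by simp
  qed
  moreover have "integral {0..1} (\<lambda>u. profile n (r * u) * (r * u) ^ (n + 1)) =
      r ^ (n + 1) * integral {0..1} (\<lambda>u. profile n (r * u) * u ^ (n + 1))"
    by (simp add: power_mult_distrib mult_ac flip: integral_mult_right)
  ultimately have "integral {0..r} (\<lambda>t. Ud (n + 2) t * t) =
      r ^ (n + 2) * integral {0..1} (\<lambda>u. profile n (r * u) * u ^ (n + 1))"
    using assms by (simp add: field_simps)
  then show ?thesis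
    using assms by (simp only: Wd_def Wd_const_def) simp
qed

lemma Wd_antimono:
  assumes "0 < r" "r \<le> s"
  shows "Wd (n + 2) s \<le> Wd (n + 2) r"
proof -
  have "(\<lambda>u. profile n (r * u) * u ^ (n + 1)) integrable_on {0..1}" for r
    by (intro integrable_continuous_interval continuous_intros
        continuous_on_compose2 [OF continuous_on_profile [of UNIV]]) auto
  then have "integral {0..1} (\<lambda>u. profile n (s * u) * u ^ (n + 1)) \<le>
      integral {0..1} (\<lambda>u. profile n (r * u) * u ^ (n + 1))"
    using assms by (intro integral_le mult_right_mono profile_antimono) auto
  then show ?thesis
    using assms Wd_const_pos [of "n + 2"] by (simp only: Wd_eq_average) (simp add: mult_left_mono)
qed

section \<open>The value of \<open>Wd\<close> on the unit interval\<close>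

lemma Gamma_legendre_duplication_real:
  fixes z :: real
  assumes "0 < z"
  shows "Gamma z * Gamma (z + 1 / 2) = 2 powr (1 - 2 * z) * sqrt pi * Gamma (2 * z)"
proof -
  have "complex_of_real z \<notin> \<int>\<^sub>\<le>\<^sub>0" "complex_of_real (z + 1 / 2) \<notin> \<int>\<^sub>\<le>\<^sub>0"
    using assms unfolding of_real_in_nonpos_Ints_iff by (auto elim!: nonpos_Ints_cases)
  then have "Gamma (complex_of_real z) * Gamma (complex_of_real z + 1 / 2) =
      exp ((1 - 2 * complex_of_real z) * of_real (ln 2)) * of_real (sqrt pi) * Gamma (2 * complex_of_real z)"
    by (intro Gamma_legendre_duplication) auto
  also have "Gamma (complex_of_real z) * Gamma (complex_of_real z + 1 / 2) =
      complex_of_real (Gamma z * Gamma (z + 1 / 2))"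
    by (simp flip: Gamma_complex_of_real)
  also have "exp ((1 - 2 * complex_of_real z) * of_real (ln 2)) * of_real (sqrt pi) *
      Gamma (2 * complex_of_real z) = complex_of_real (exp ((1 - 2 * z) * ln 2) * sqrt pi * Gamma (2 * z))"
    by (simp flip: Gamma_complex_of_real exp_of_real)
  finally have "Gamma z * Gamma (z + 1 / 2) = exp ((1 - 2 * z) * ln 2) * sqrt pi * Gamma (2 * z)"
    by (rule of_real_eq_iff [THEN iffD1])
  then show ?thesis by (simp add: powr_def)
qed

text \<open>For \<open>0 < r \<le> 1\<close> the profile is constant on the whole range of
  integration, so only a power of \<open>u\<close> is integrated. What remains is an identity
  between Gamma values, matching the prescribed value at \<open>0\<close>.\<close>

lemma Wd_le_1:
  assumes "0 \<le> r" "r \<le> 1"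
  shows "Wd (n + 2) r = unit_ball_vol (real (n + 2)) / (2 * pi) ^ (n + 2)"
proof (cases "r = 0")
  case False
  then have "0 < r" using assms by simp
  have "integral {0..1} (\<lambda>u. profile n (r * u) * u ^ (n + 1)) =
      integral {0..1} (\<lambda>u. sin_pow_integral n (pi / 2) / pi * u ^ (n + 1))"
    using assms by (intro integral_cong) (simp add: profile_le_1 mult_le_one)
  also have "\<dots> = sin_pow_integral n (pi / 2) / pi * integral {0..1} (\<lambda>u. u ^ (n + 1))"
    by (rule integral_mult_right)
  also have "integral {0..1} (\<lambda>u::real. u ^ (n + 1)) = 1 / (real n + 2)"
  proof -
    have "((\<lambda>u::real. u ^ (n + 1)) has_integral (1 ^ (n + 2) / real (n + 2) - 0 ^ (n + 2) / real (n + 2))) {0..1}"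
    proof (intro fundamental_theorem_of_calculus)
      fix u :: real
      have "((\<lambda>u. u ^ (n + 2) / real (n + 2)) has_real_derivative u ^ (n + 1)) (at u within {0..1})"
        using DERIV_cdivide [OF DERIV_pow [of "n + 2" u "{0..1}"], of "real (n + 2)"]
        by simp
      then show "((\<lambda>u. u ^ (n + 2) / real (n + 2)) has_vector_derivative u ^ (n + 1)) (at u within {0..1})"
        by (simp add: has_real_derivative_iff_has_vector_derivative)
    qed simp
    then show ?thesis by (simp add: integral_unique)
  qed
  finally have W: "Wd (n + 2) r =
      Wd_const (n + 2) * (sin_pow_integral n (pi / 2) / pi * (1 / (real n + 2)))"
    unfolding Wd_eq_average [OF \<open>0 < r\<close>] by simp
  let ?z = "(real n + 1) / 2" and ?p = "pi powr (real n / 2 + 1)"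
  \<comment> \<open>Duplication at \<open>z = (n + 1) / 2\<close>, where
    \<open>2 * z = n + 1\<close> and \<open>2 powr (1 - 2 * z)\<close> is
    \<open>1 / 2 ^ n\<close>.\<close>
  have dup: "Gamma ?z * Gamma (real n / 2 + 1) = sqrt pi * Gamma (real n + 1) / 2 ^ n"
  proof -
    have eqs: "1 - 2 * ?z = - real n" "2 * ?z = real n + 1" "?z + 1 / 2 = real n / 2 + 1"
      by (simp_all add: field_simps)
    have "0 < ?z" by simp
    from Gamma_legendre_duplication_real [OF this] show ?thesis
      unfolding eqs by (simp add: powr_minus powr_realpow inverse_eq_divide)
  qed
  have pp: "?p * ?p = pi ^ (n + 2)"
    using powr_realpow [of pi "n + 2"] by (simp add: add.commute flip: powr_add)
  have G: "Gamma (real n / 2 + 1 + 1) = (real n / 2 + 1) * Gamma (real n / 2 + 1)"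
    by (rule Gamma_plus1_pos) (simp add: add_nonneg_pos)
  have e: "real (n + 2) / 2 = real n / 2 + 1" "real (n + 2) - 1 = real n + 1" by simp_all
  \<comment> \<open>Opaque positive names reduce the rest to rational arithmetic.\<close>
  define A B C P K where "A = Gamma (real n / 2 + 1)" and "B = Gamma (real n + 1)"
    and "C = Gamma ?z" and "P = ?p" and "K = real n + 2"
  note defs = this
  have pos: "0 < A" "0 < B" "0 < C" "0 < P" "0 < K"
    unfolding defs by (auto intro!: Gamma_real_pos simp: add_nonneg_pos)
  have "Wd (n + 2) r = C * sqrt pi / (2 * B * P * pi * K)"
    unfolding W Wd_const_def sphere_vol_def e sin_pow_integral_pi_half defs [symmetric]
    using pos by (simp add: divide_simps)
  \<comment> \<open>Expanding by \<open>A\<close> produces the product \<open>C * A\<close> to which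
    duplication applies; a later expansion by \<open>P\<close> similarly produces
    \<open>P * P\<close>, an integer power of \<open>pi\<close>.\<close>
  also have "\<dots> = (C * A * sqrt pi) / (2 * B * P * pi * K * A)"
    using pos by (simp add: divide_simps)
  also have "C * A * sqrt pi = pi * B / 2 ^ n"
    using dup unfolding defs by simp
  also have "pi * B / 2 ^ n / (2 * B * P * pi * K * A) = P / (2 ^ (n + 1) * (P * P) * K * A)"
    using pos by (simp add: divide_simps)
  also have "P * P = pi ^ (n + 2)"
    using pp unfolding defs .
  also have "P / (2 ^ (n + 1) * pi ^ (n + 2) * K * A) = P / (K / 2 * A) / (2 ^ (n + 2) * pi ^ (n + 2))"
    using pos by (simp add: divide_simps)
  \<comment> \<open>This is the Gamma value in the denominator of
    \<open>unit_ball_vol (real (n + 2))\<close>.\<close>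
  also have "K / 2 * A = Gamma (real n / 2 + 1 + 1)"
    unfolding G by (simp add: A_def K_def add_divide_distrib)
  also have "P / Gamma (real n / 2 + 1 + 1) / (2 ^ (n + 2) * pi ^ (n + 2)) =
      unit_ball_vol (real (n + 2)) / (2 * pi) ^ (n + 2)"
    unfolding unit_ball_vol_def e P_def power_mult_distrib ..
  finally show ?thesis .
qed (simp add: Wd_def)

theorem corollary3p12:
  fixes d :: nat
  assumes "d \<ge> 2"
  shows "scaled_Ud d constant_on {0..1} \<and> antimono_on {1..} (scaled_Ud d) \<and>
         Wd d constant_on {0..1} \<and> antimono_on {1..} (Wd d)"
proof -
  obtain n where d: "d = n + 2"
    using assms le_Suc_ex by (metis add.commute)
  have "scaled_Ud d constant_on {0..1}"
    \<comment> \<open>Deleting \<open>add_2_eq_Suc'\<close> keeps the argument in the form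
      \<open>n + 2\<close>, as the rewrite rules expect it.\<close>
    unfolding constant_on_def d by (auto simp: scaled_Ud_eq_profile profile_le_1 simp del: add_2_eq_Suc')
  moreover have "antimono_on {1..} (scaled_Ud d)"
    unfolding d by (rule monotone_onI) (simp add: scaled_Ud_eq_profile profile_antimono del: add_2_eq_Suc')
  moreover have "Wd d constant_on {0..1}"
    unfolding constant_on_def d by (auto simp: Wd_le_1 simp del: add_2_eq_Suc')
  moreover have "antimono_on {1..} (Wd d)"
    unfolding d by (rule monotone_onI) (simp add: Wd_antimono del: add_2_eq_Suc')
  ultimately show ?thesis by blast
qed

end
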